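(* For all positive integers $k,\ell,r$ there exists a real number $p=p_{k,\ell,r}>0$, depending only on $k,\ell,r$, such that for every measurable function $f:\mathbb{R}^k\to\{1,\dots,r\}$ and every sequence $\{U_i\}_{i\in\mathbb{N}}$ of i.i.d. real-valued random variables, setting $Z^f_i=f(U_i,\dots,U_{i+k-1})$ for $i\ge 1$, one has $$\mathbb{P}(Z^f_1=Z^f_2=\dots=Z^f_\ell)>p.$$
   Context: $\mathbb{N}=\{1,2,3,\dots\}$. The process $Z^f_i=f(U_i,\dots,U_{i+k-1})$ is called a $k$-block factor (sliding window process). For $\ell=1$ the chain of equalities is vacuous, so the event has probability $1$. *)

theory Defs
  imports "HOL-Probability.Probability"
begin

definition iid_sequence :: "'a measure \<Rightarrow> (nat \<Rightarrow> 'a \<Rightarrow> real) \<Rightarrow> bool" where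
  "iid_sequence M U \<longleftrightarrow>
     prob_space.indep_vars M (\<lambda>_. borel) U {1..} \<and>
     (\<forall>i\<in>{1..}. distr M borel (U i) = distr M borel (U 1))"

text \<open>
  A point of \<open>\<real>\<^sup>k\<close> is an extensional function on \<open>{..<k}\<close>, so that the Borel sigma-algebra
  of \<open>\<real>\<^sup>k\<close> is that of the product measure space \<open>\<Pi>\<^sub>M j\<in>{..<k}. borel\<close>.
\<close>

definition block_factor ::
    "nat \<Rightarrow> ((nat \<Rightarrow> real) \<Rightarrow> nat) \<Rightarrow> (nat \<Rightarrow> 'a \<Rightarrow> real) \<Rightarrow> nat \<Rightarrow> 'a \<Rightarrow> nat" where
  "block_factor k f U i \<omega> = f (\<lambda>j\<in>{..<k}. U (i + j) \<omega>)"

text \<open>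
  The first argument only names the type of the sample points: the bound is required for all
  probability spaces over that type.
\<close>

definition constant_run_bound :: "'a itself \<Rightarrow> nat \<Rightarrow> nat \<Rightarrow> nat \<Rightarrow> real \<Rightarrow> bool" where
  "constant_run_bound T k l r p \<longleftrightarrow>
     (\<forall>f (M :: 'a measure) U.
        f \<in> (\<Pi>\<^sub>M j\<in>{..<k}. (borel :: real measure)) \<rightarrow>\<^sub>M count_space {1..r} \<longrightarrow>
        prob_space M \<longrightarrow> iid_sequence M U \<longrightarrow>
        measure M {\<omega> \<in> space M.
          \<forall>i\<in>{1..<l}. block_factor k f U i \<omega> = block_factor k f U (Suc i) \<omega>} > p)"

text \<open>
  HOL cannot quantify over all sample-space types behind an existential quantifier, and
  \<open>\<exists>p>0. constant_run_bound TYPE('a) k l r p\<close> with free \<open>'a\<close> would let \<open>p\<close> depend on \<open>'a\<close>.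
  That one \<open>p\<close> serves all types is therefore expressed by two statements: some \<open>p > 0\<close> is a
  bound over the fixed type \<^typ>\<open>nat \<Rightarrow> real\<close> (which carries the canonical i.i.d. sequences, the
  coordinates of an infinite product), and every bound over that type is one over \<open>'a\<close>.
\<close>

end

theory Submission
  imports Defs "HOL-Library.Ramsey"
begin

text \<open>
  Colour each increasing \<open>k\<close>-tuple of indices \<open>i\<^sub>1 < \<dots> < i\<^sub>k\<close> by \<open>f (U i\<^sub>1, \<dots>, U i\<^sub>k)\<close>. By Ramsey's
  theorem for \<open>k\<close>-uniform hypergraphs, every outcome has a homogeneous set of \<open>l + k - 1\<close> indices
  below some \<open>N = N(k, l, r)\<close>, and along it the block factor is constant for \<open>l\<close> steps. The
  subsequence of \<open>U\<close> along any fixed set of indices has the law of \<open>U\<close> itself, so the union bound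
  shows that the event in question has at least the reciprocal of the number of index sets as its
  probability. This probability depends only on the law of \<open>U 1\<close>, and every law on the line is
  that of the coordinate process on a space of sequences.
\<close>

text \<open>Ramsey's theorem colours \<open>k\<close>-element sets; a colouring of lists induces one
  through increasing enumeration. Only windows of consecutive entries of the homogeneous list are
  kept, since these are the arguments of the block factor along the chosen subsequence.
  \<open>N\<close> is fixed before \<open>c\<close>, as the colouring will vary with the
  outcome.\<close>

lemma ramsey_windows:
  fixes k m r :: nat
  shows "\<exists>N. \<forall>c. (\<forall>xs :: nat list. length xs = k \<longrightarrow> c xs \<in> {1..r}) \<longrightarrow>
    (\<exists>xs q. sorted_wrt (<) xs \<and> set xs \<subseteq> {..<N} \<and> length xs = m \<and>
       (\<forall>i. i + k \<le> m \<longrightarrow> c (take k (drop i xs)) = (q :: nat)))"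
proof -
  obtain N :: nat where N: "partn_lst {..<N} (replicate r m) k"
    using ramsey_full by blast
  show ?thesis
  proof (intro exI[of _ N] allI impI)
    fix c :: "nat list \<Rightarrow> nat"
    assume c: "\<forall>xs. length xs = k \<longrightarrow> c xs \<in> {1..r}"
    \<comment> \<open>\<open>partn_lst\<close> numbers the colours from 0. The truncated subtraction
      loses nothing on \<open>{1..r}\<close>, so colour \<open>q\<close> there means
      \<open>c\<close>-value \<open>Suc q\<close>.\<close>
    have "(\<lambda>S. c (sorted_list_of_set S) - 1) \<in> nsets {..<N} k \<rightarrow> {..<length (replicate r m)}"
    proof
      fix S assume "S \<in> nsets {..<N} k"
      then have "c (sorted_list_of_set S) \<in> {1..r}"
        using c by (auto simp: nsets_def)
      then show "c (sorted_list_of_set S) - 1 \<in> {..<length (replicate r m)}"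
        by auto
    qed
    with N obtain q where q: "q < r"
      and "monochromatic {..<N} (replicate r m ! q) k (\<lambda>S. c (sorted_list_of_set S) - 1) q"
      unfolding partn_lst_def by (metis length_replicate)
    then obtain H where H: "H \<in> nsets {..<N} m"
      and mono: "\<And>S. S \<in> nsets H k \<Longrightarrow> c (sorted_list_of_set S) - 1 = q"
      unfolding monochromatic_def by (auto simp: image_subset_iff)
    define xs where "xs = sorted_list_of_set H"
    have xs: "sorted_wrt (<) xs" "set xs = H" "length xs = m"
      using H by (auto simp: xs_def nsets_def)
    have "c (take k (drop i xs)) = Suc q" if i: "i + k \<le> m" for i
    proof -
      let ?ys = "take k (drop i xs)"
      have ys: "sorted_wrt (<) ?ys" "length ?ys = k" "set ?ys \<subseteq> H"
        using xs i by (auto intro: sorted_wrt_take sorted_wrt_drop dest: in_set_takeD in_set_dropD)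
      then have "distinct ?ys" "sorted ?ys" by (simp_all add: strict_sorted_iff)
      with ys have "set ?ys \<in> nsets H k"
        by (simp add: nsets_def distinct_card)
      moreover have "sorted_list_of_set (set ?ys) = ?ys"
        using \<open>distinct ?ys\<close> \<open>sorted ?ys\<close>
        by (simp add: sorted_list_of_set.idem_if_sorted_distinct)
      moreover have "c ?ys \<in> {1..r}" using c ys by blast
      ultimately show ?thesis using mono[of "set ?ys"] by auto
    qed
    then show "\<exists>xs q. sorted_wrt (<) xs \<and> set xs \<subseteq> {..<N} \<and> length xs = m \<and>
       (\<forall>i. i + k \<le> m \<longrightarrow> c (take k (drop i xs)) = q)"
      using xs H by (intro exI[of _ xs] exI[of _ "Suc q"]) (auto simp: nsets_def)
  qed
qed

text \<open>Stated for a deterministic sequence indexed from 0, so that the same event can be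
  evaluated along any subsequence and on any sample space.\<close>

definition constant_run :: "nat \<Rightarrow> nat \<Rightarrow> ((nat \<Rightarrow> real) \<Rightarrow> nat) \<Rightarrow> (nat \<Rightarrow> real) \<Rightarrow> bool" where
  "constant_run k l f x \<longleftrightarrow>
     (\<forall>i. Suc i < l \<longrightarrow> f (\<lambda>j\<in>{..<k}. x (i + j)) = f (\<lambda>j\<in>{..<k}. x (Suc i + j)))"

lemma constant_run_cong:
  assumes "\<And>j. j < l + k - 1 \<Longrightarrow> x j = y j"
  shows "constant_run k l f x \<longleftrightarrow> constant_run k l f y"
proof -
  \<comment> \<open>A window starting below \<open>l\<close> reaches at most index
    \<open>l + k - 2\<close>.\<close>
  have "(\<lambda>j\<in>{..<k}. x (i + j)) = (\<lambda>j\<in>{..<k}. y (i + j))" if "i < l" for i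
    using that by (intro restrict_ext assms) auto
  then show ?thesis
    unfolding constant_run_def by (auto dest: Suc_lessD simp del: add_Suc)
qed

lemma constant_run_block_factor:
  "(\<forall>i\<in>{1..<l}. block_factor k f U i \<omega> = block_factor k f U (Suc i) \<omega>) \<longleftrightarrow>
    constant_run k l f (\<lambda>j. U (Suc j) \<omega>)"
proof -
  have "(\<forall>i\<in>{1..<l}. P i) \<longleftrightarrow> (\<forall>i. Suc i < l \<longrightarrow> P (Suc i))" for P
    by (auto simp: Ball_def gr0_conv_Suc Suc_le_eq)
  then show ?thesis
    by (simp add: constant_run_def block_factor_def)
qed

lemma sets_constant_run:
  assumes f: "f \<in> (\<Pi>\<^sub>M j\<in>{..<k}. (borel :: real measure)) \<rightarrow>\<^sub>M count_space {1..r}"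
  shows "{x \<in> space (\<Pi>\<^sub>M j\<in>{..<l + k - 1}. borel). constant_run k l f x}
    \<in> sets (\<Pi>\<^sub>M j\<in>{..<l + k - 1}. borel)" (is "_ \<in> sets ?P")
proof -
  define F where "F i x = f (\<lambda>j\<in>{..<k}. x (i + j))" for i x
  have F: "F i \<in> ?P \<rightarrow>\<^sub>M count_space {1..r}" if "i < l" for i
    unfolding F_def
  proof (rule measurable_compose[OF _ f], rule measurable_restrict)
    fix j assume "j \<in> {..<k}"
    with that have "i + j \<in> {..<l + k - 1}" by auto
    then show "(\<lambda>x. x (i + j)) \<in> ?P \<rightarrow>\<^sub>M borel"
      by (rule measurable_component_singleton)
  qed
  have "{x \<in> space ?P. F i x = F (Suc i) x} \<in> sets ?P" if "i \<in> {i. Suc i < l}" for i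
  proof -
    have i: "i < l" "Suc i < l"
      using that by auto
    \<comment> \<open>Since \<open>f\<close> takes values in the finite set \<open>{1..r}\<close>,
      equality of two windows is a finite union over their common value.\<close>
    have "{x \<in> space ?P. F i x = F (Suc i) x} =
        (\<Union>c\<in>{1..r}. (F i -` {c} \<inter> space ?P) \<inter> (F (Suc i) -` {c} \<inter> space ?P))"
      (is "?L = ?R")
    proof
      show "?L \<subseteq> ?R"
        using measurable_space[OF F[OF i(2)]] by fastforce
      show "?R \<subseteq> ?L" by fastforce
    qed
    also have "\<dots> \<in> sets ?P"
      by (intro sets.finite_UN sets.Int measurable_sets[OF F[OF i(1)]]
          measurable_sets[OF F[OF i(2)]]) auto
    finally show ?thesis .
  qed
  then have "{x \<in> space ?P. \<forall>i\<in>{i. Suc i < l}. F i x = F (Suc i) x} \<in> sets ?P"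
    by (rule sets.sets_Collect_countable_All'[OF _ countableI_type])
  also have "{x \<in> space ?P. \<forall>i\<in>{i. Suc i < l}. F i x = F (Suc i) x} =
      {x \<in> space ?P. constant_run k l f x}"
    unfolding constant_run_def F_def by blast
  finally show ?thesis .
qed

lemma iid_sequenceD:
  assumes "iid_sequence M U" "prob_space M" "i \<ge> 1"
  shows "U i \<in> M \<rightarrow>\<^sub>M borel" "distr M borel (U i) = distr M borel (U 1)"
proof -
  have "i \<in> {1..}"
    using assms(3) by simp
  with assms(1) show "U i \<in> M \<rightarrow>\<^sub>M borel" "distr M borel (U i) = distr M borel (U 1)"
    unfolding iid_sequence_def prob_space.indep_vars_def2[OF assms(2)] by blast+
qed

text \<open>The joint law of the whole sequence is a power of the law of \<open>U 1\<close>, and an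
  injective reindexing maps one such power to another.\<close>

lemma distr_iid_subsequence:
  assumes M: "prob_space M" and iid: "iid_sequence M U"
    and g: "inj_on g J" "g \<in> J \<rightarrow> {1..}"
  shows "distr M (\<Pi>\<^sub>M j\<in>J. borel) (\<lambda>\<omega>. \<lambda>j\<in>J. U (g j) \<omega>) = (\<Pi>\<^sub>M j\<in>J. distr M borel (U 1))"
proof -
  interpret prob_space M by fact
  let ?D = "distr M borel (U 1)" and ?X = "\<lambda>\<omega>. \<lambda>i\<in>{1..}. U i \<omega>"
    and ?P = "\<Pi>\<^sub>M i\<in>{1::nat..}. (borel :: real measure)"
  note U = iid_sequenceD[OF iid M]
  have D: "prob_space ?D"
    using U(1)[of 1] by (simp add: prob_space_distr)
  have X: "?X \<in> M \<rightarrow>\<^sub>M ?P"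
    using U(1) by (intro measurable_restrict) auto
  have t: "(\<lambda>x. \<lambda>j\<in>J. x (g j)) \<in> ?P \<rightarrow>\<^sub>M (\<Pi>\<^sub>M j\<in>J. borel)"
    using g(2) by (intro measurable_restrict measurable_component_singleton) auto
  have "distr M ?P ?X = (\<Pi>\<^sub>M i\<in>{1..}. distr M borel (U i))"
    using iid U(1) indep_vars_iff_distr_eq_PiM'[of "{1..}" U "\<lambda>_. borel"]
    by (auto simp: iid_sequence_def)
  also have "\<dots> = (\<Pi>\<^sub>M i\<in>{1..}. ?D)"
    by (intro PiM_cong refl U(2)) auto
  finally have law: "distr M ?P ?X = (\<Pi>\<^sub>M i\<in>{1..}. ?D)" .
  have "distr M (\<Pi>\<^sub>M j\<in>J. borel) (\<lambda>\<omega>. \<lambda>j\<in>J. U (g j) \<omega>) =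
      distr (distr M ?P ?X) (\<Pi>\<^sub>M j\<in>J. borel) (\<lambda>x. \<lambda>j\<in>J. x (g j))"
    unfolding distr_distr[OF t X] using g(2)
    by (intro distr_cong) (auto simp: fun_eq_iff)
  also have "\<dots> = distr (\<Pi>\<^sub>M i\<in>{1..}. ?D) (\<Pi>\<^sub>M j\<in>J. ?D) (\<lambda>x. \<lambda>j\<in>J. x (g j))"
    unfolding law by (intro distr_cong sets_PiM_cong) auto
  also have "\<dots> = (\<Pi>\<^sub>M j\<in>J. ?D)"
    using distr_PiM_reindex[OF D g] .
  finally show ?thesis .
qed

text \<open>The right-hand side mentions neither \<open>g\<close> nor the sample space beyond the
  law of \<open>U 1\<close>. The first fact makes all index lists equally likely to give a run; the
  second allows a change of sample space.\<close>

lemma prob_constant_run: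
  fixes M :: "'a measure" and f :: "(nat \<Rightarrow> real) \<Rightarrow> nat"
  assumes f: "f \<in> (\<Pi>\<^sub>M j\<in>{..<k}. (borel :: real measure)) \<rightarrow>\<^sub>M count_space {1..r}"
    and M: "prob_space M" and iid: "iid_sequence M U"
    and g: "inj_on g {..<l + k - 1}" "g \<in> {..<l + k - 1} \<rightarrow> {1..}"
  defines "A \<equiv> {\<omega> \<in> space M. constant_run k l f (\<lambda>j. U (g j) \<omega>)}"
  shows "A \<in> sets M"
    and "measure M A = measure (\<Pi>\<^sub>M j\<in>{..<l + k - 1}. distr M borel (U 1))
      {x \<in> space (\<Pi>\<^sub>M j\<in>{..<l + k - 1}. borel). constant_run k l f x}"
      (is "_ = measure _ ?E")
proof -
  let ?P = "\<Pi>\<^sub>M j\<in>{..<l + k - 1}. (borel :: real measure)"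
    and ?X = "\<lambda>\<omega>. \<lambda>j\<in>{..<l + k - 1}. U (g j) \<omega>"
  have X: "?X \<in> M \<rightarrow>\<^sub>M ?P"
    using iid_sequenceD(1)[OF iid M] g(2) by (intro measurable_restrict) auto
  have "constant_run k l f (?X \<omega>) \<longleftrightarrow> constant_run k l f (\<lambda>j. U (g j) \<omega>)" for \<omega>
    by (intro constant_run_cong) auto
  then have A: "A = ?X -` ?E \<inter> space M"
    using measurable_space[OF X] by (auto simp: A_def)
  show "A \<in> sets M"
    unfolding A using X sets_constant_run[OF f] by (rule measurable_sets)
  show "measure M A = measure (\<Pi>\<^sub>M j\<in>{..<l + k - 1}. distr M borel (U 1)) ?E"
    unfolding A distr_iid_subsequence[OF M iid g, symmetric]
    using X sets_constant_run[OF f] by (rule measure_distr[symmetric])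
qed

lemma prob_constant_run_block_factor:
  fixes M :: "'a measure"
  assumes f: "f \<in> (\<Pi>\<^sub>M j\<in>{..<k}. (borel :: real measure)) \<rightarrow>\<^sub>M count_space {1..r}"
    and M: "prob_space M" and iid: "iid_sequence M U"
  shows "measure M {\<omega> \<in> space M.
      \<forall>i\<in>{1..<l}. block_factor k f U i \<omega> = block_factor k f U (Suc i) \<omega>} =
    measure (\<Pi>\<^sub>M j\<in>{..<l + k - 1}. distr M borel (U 1))
      {x \<in> space (\<Pi>\<^sub>M j\<in>{..<l + k - 1}. borel). constant_run k l f x}"
  unfolding constant_run_block_factor 
  using prob_constant_run(2)[OF f M iid, where g = Suc and l = l] by simp

lemma ex_constant_run_bound:
  "\<exists>p>0. constant_run_bound TYPE('a) k l r p"
proof -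
  let ?m = "l + k - 1"
  obtain N where N: "\<And>c. (\<And>xs :: nat list. length xs = k \<Longrightarrow> c xs \<in> {1..r}) \<Longrightarrow>
    \<exists>xs q. sorted_wrt (<) xs \<and> set xs \<subseteq> {..<N} \<and> length xs = ?m \<and>
       (\<forall>i. i + k \<le> ?m \<longrightarrow> c (take k (drop i xs)) = (q :: nat))"
    using ramsey_windows[of k r ?m] by blast
  define F where "F = {xs. sorted_wrt (<) xs \<and> set xs \<subseteq> {..<N} \<and> length xs = ?m}"
  have "finite F"
    by (rule finite_subset[OF _ finite_lists_length_eq[of "{..<N}" ?m]]) (auto simp: F_def)
  \<comment> \<open>\<open>F\<close> is fixed before \<open>f\<close>, \<open>M\<close> and
    \<open>U\<close>. The union bound alone gives a weak inequality with \<open>card F\<close>;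
    adding 1 makes it strict and keeps the denominator positive.\<close>
  have "constant_run_bound TYPE('a) k l r (1 / (card F + 1))"
    unfolding constant_run_bound_def
  proof (intro allI impI)
    fix f U and M :: "'a measure"
    assume f: "f \<in> (\<Pi>\<^sub>M j\<in>{..<k}. (borel :: real measure)) \<rightarrow>\<^sub>M count_space {1..r}"
      and M: "prob_space M" and iid: "iid_sequence M U"
    interpret prob_space M by fact
    let ?P = "prob {\<omega> \<in> space M.
        \<forall>i\<in>{1..<l}. block_factor k f U i \<omega> = block_factor k f U (Suc i) \<omega>}"
    \<comment> \<open>\<open>Suc\<close> moves the indices below \<open>N\<close> into
      \<open>{1..}\<close>, where \<open>U\<close> is i.i.d.\<close>
    define A where "A xs = {\<omega> \<in> space M. constant_run k l f (\<lambda>j. U (Suc (xs ! j)) \<omega>)}" for xs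
    have A: "A xs \<in> events \<and> prob (A xs) = ?P" if "xs \<in> F" for xs
    proof -
      have "inj_on (\<lambda>j. Suc (xs ! j)) {..<?m}"
        using that by (auto simp: F_def inj_on_def strict_sorted_iff nth_eq_iff_index_eq)
      from prob_constant_run[OF f M iid this] show ?thesis
        unfolding A_def prob_constant_run_block_factor[OF f M iid] by auto
    qed
    have "space M \<subseteq> (\<Union>xs\<in>F. A xs)"
    proof
      fix \<omega> assume \<omega>: "\<omega> \<in> space M"
      \<comment> \<open>The outcome is fixed here: the homogeneous list depends on it, but always
        lies in the finite set \<open>F\<close>.\<close>
      define c where "c ys = f (\<lambda>j\<in>{..<k}. U (Suc (ys ! j)) \<omega>)" for ys
      have "c ys \<in> {1..r}" for ys
      proof -
        have "(\<lambda>j\<in>{..<k}. U (Suc (ys ! j)) \<omega>) \<in> space (\<Pi>\<^sub>M j\<in>{..<k}. (borel :: real measure))"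
          by (simp add: space_PiM)
        from measurable_space[OF f this] show ?thesis
          by (simp add: c_def)
      qed
      from N[of c, OF this] obtain xs q where xs: "xs \<in> F"
        and q: "\<And>i. i + k \<le> ?m \<Longrightarrow> c (take k (drop i xs)) = q"
        unfolding F_def by blast
      \<comment> \<open>The length \<open>l + k - 1\<close> of \<open>xs\<close> leaves room for a
        window at every start below \<open>l\<close>.\<close>
      have "f (\<lambda>j\<in>{..<k}. U (Suc (xs ! (i + j))) \<omega>) = q" if "i < l" for i
      proof -
        have "(\<lambda>j\<in>{..<k}. U (Suc (xs ! (i + j))) \<omega>) =
            (\<lambda>j\<in>{..<k}. U (Suc (take k (drop i xs) ! j)) \<omega>)"
          using xs that by (intro restrict_ext) (auto simp: F_def)
        then show ?thesis
          using q[of i] that by (simp add: c_def)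
      qed
      then have "\<omega> \<in> A xs"
        using \<omega> by (simp add: A_def constant_run_def del: add_Suc)
      with xs show "\<omega> \<in> (\<Union>xs\<in>F. A xs)" by blast
    qed
    then have "1 \<le> prob (\<Union>xs\<in>F. A xs)"
      using A \<open>finite F\<close> by (subst prob_space[symmetric], intro finite_measure_mono) auto
    also have "\<dots> \<le> (\<Sum>xs\<in>F. prob (A xs))"
      using A \<open>finite F\<close> by (intro finite_measure_subadditive_finite) auto
    also have "\<dots> = card F * ?P"
      using A by simp
    finally have "1 \<le> card F * ?P" .
    moreover from this have "?P > 0"
      by (smt (verit) mult_nonneg_nonpos of_nat_0_le_iff)
    ultimately have "1 < ?P * (card F + 1)"
      by (simp add: algebra_simps)
    then show "?P > 1 / (card F + 1)"
      by (simp add: divide_less_eq)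
  qed
  moreover have "0 < 1 / real (card F + 1)" by simp
  ultimately show ?thesis by (intro exI conjI)
qed

text \<open>Realises an arbitrary law \<open>D\<close> on the line by an i.i.d. sequence whose
  sample points have the type \<open>nat \<Rightarrow> real\<close>.\<close>

lemma iid_sequence_coordinates:
  assumes D: "prob_space D" and sets: "sets D = sets borel"
  defines "C \<equiv> \<Pi>\<^sub>M i\<in>{1::nat..}. (D :: real measure)"
  shows "prob_space C" "iid_sequence C (\<lambda>i x. x i)" "distr C borel (\<lambda>x. x 1) = D"
proof -
  show "prob_space C"
    unfolding C_def using D by (rule prob_space_PiM)
  then interpret prob_space C .
  have coord: "distr C borel (\<lambda>x. x i) = D" if "i \<ge> 1" for i
  proof -
    have "distr C borel (\<lambda>x. x i) = distr C D (\<lambda>x. x i)"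
      using sets by (intro distr_cong) auto
    also have "\<dots> = D"
      unfolding C_def using D that by (intro distr_PiM_component) auto
    finally show ?thesis .
  qed
  then show "distr C borel (\<lambda>x. x 1) = D" by simp
  have "(\<lambda>x. x i) \<in> C \<rightarrow>\<^sub>M borel" if "i \<ge> 1" for i
    using that measurable_component_singleton[of i "{1..}" "\<lambda>_. D"]
    unfolding C_def measurable_cong_sets[OF refl sets] by simp
  moreover have "distr C (\<Pi>\<^sub>M i\<in>{1..}. borel) (\<lambda>x. \<lambda>i\<in>{1..}. x i) =
      (\<Pi>\<^sub>M i\<in>{1..}. distr C borel (\<lambda>x. x i))"
  proof -
    \<comment> \<open>Points of \<open>C\<close> are extensional on \<open>{1..}\<close>, so
      restricting them is the identity; the joint law of the coordinates is \<open>C\<close>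
      itself.\<close>
    have "distr C (\<Pi>\<^sub>M i\<in>{1..}. borel) (\<lambda>x. \<lambda>i\<in>{1..}. x i) = distr C C (\<lambda>x. x)"
      unfolding C_def using sets
      by (intro distr_cong sets_PiM_cong) (auto simp: space_PiM PiE_restrict)
    also have "\<dots> = C" by simp
    also have "\<dots> = (\<Pi>\<^sub>M i\<in>{1..}. distr C borel (\<lambda>x. x i))"
      unfolding C_def using coord[unfolded C_def] by (intro PiM_cong) auto
    finally show ?thesis .
  qed
  ultimately have "indep_vars (\<lambda>_. borel) (\<lambda>i x. x i) {1..}"
    using indep_vars_iff_distr_eq_PiM'[of "{1..}" "\<lambda>i x. x i" "\<lambda>_. borel"] by auto
  then show "iid_sequence C (\<lambda>i x. x i)"
    using coord by (simp add: iid_sequence_def)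
qed

text \<open>\<open>ex_constant_run_bound\<close> yields a bound for each sample type, but not
  visibly the same one. Here \<open>p\<close> is kept: the coordinate process with the law of
  \<open>U 1\<close> has the same run probability as \<open>U\<close>, and the assumed bound applies
  to it.\<close>

lemma constant_run_bound_transfer:
  assumes bound: "constant_run_bound TYPE(nat \<Rightarrow> real) k l r p"
  shows "constant_run_bound TYPE('a) k l r p"
  unfolding constant_run_bound_def
proof (intro allI impI)
  fix f U and M :: "'a measure"
  assume f: "f \<in> (\<Pi>\<^sub>M j\<in>{..<k}. (borel :: real measure)) \<rightarrow>\<^sub>M count_space {1..r}"
    and M: "prob_space M" and iid: "iid_sequence M U"
  let ?D = "distr M borel (U 1)"
  have D: "prob_space ?D"
    using prob_space.prob_space_distr[OF M iid_sequenceD(1)[OF iid M, of 1]] by simp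
  note C = iid_sequence_coordinates[OF D sets_distr]
  let ?C = "\<Pi>\<^sub>M i\<in>{1::nat..}. ?D" and ?x = "\<lambda>i x. x i :: real"
  have "p < measure ?C {\<omega> \<in> space ?C.
      \<forall>i\<in>{1..<l}. block_factor k f ?x i \<omega> = block_factor k f ?x (Suc i) \<omega>}"
    using bound f C(1,2) unfolding constant_run_bound_def by blast
  then show "p < measure M {\<omega> \<in> space M.
      \<forall>i\<in>{1..<l}. block_factor k f U i \<omega> = block_factor k f U (Suc i) \<omega>}"
    unfolding prob_constant_run_block_factor[OF f C(1,2)] C(3)
      prob_constant_run_block_factor[OF f M iid] .
qed

theorem theorem2:
  fixes k l r :: nat
  assumes "k \<ge> 1" and "l \<ge> 1" and "r \<ge> 1"
  shows "(\<exists>p>0. constant_run_bound TYPE(nat \<Rightarrow> real) k l r p) \<and>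
    (\<forall>p. constant_run_bound TYPE(nat \<Rightarrow> real) k l r p \<longrightarrow> constant_run_bound TYPE('a) k l r p)"
  using ex_constant_run_bound constant_run_bound_transfer by blast

end
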